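(* Let $\mathcal X=\mathbb C^N$ with an inner product $\langle\cdot,\cdot\rangle$, let $\mathbb A\in\mathbb C^{N\times N}$ be invertible and $\mathbb G\in\mathbb C^{N\times N}$. Assume that $\mathbb A$ and $\mathbb G$ have the same linearly independent eigenvectors $\boldsymbol\psi_1,\dots,\boldsymbol\psi_N$ (so $\mathcal X=\mathrm{span}\{\boldsymbol\psi_k\}_{k=1}^N$), with eigenvalues $\widetilde\lambda_k$ of $\mathbb A$ and $\lambda_k$ of $\mathbb G$, and that $|\lambda_k|\in(0,1)$ for all $k$ and $|\lambda_k|\le|\lambda_{k-1}|$ for all $k\ge2$. Let $m<N$, let $\mathbf p_1,\dots,\mathbf p_m$ be linearly independent vectors whose span is $V_c=\mathrm{span}\{\boldsymbol\psi_k\}_{k=1}^m$, and define $P:\mathbb C^m\to\mathcal X$, $P\mathbf v=\sum_{k=1}^m(\mathbf v)_k\mathbf p_k$, $R:\mathcal X\to\mathbb C^m$, $R\mathbf f=[\langle\mathbf p_1,\mathbf f\rangle,\dots,\langle\mathbf p_m,\mathbf f\rangle]^\top$, $\mathbb A_c:=R\mathbb AP$ (assumed invertible), and $$\mathbb T:=(\mathbb I-P\mathbb A_c^{-1}R\mathbb A)\mathbb G.$$ Let $\widetilde T\in\mathbb C^{N\times N}$ be the matrix with entries $\widetilde t_{j,\ell}$ given by $\mathbb T\boldsymbol\psi_j=\sum_{\ell=1}^N\widetilde t_{j,\ell}\boldsymbol\psi_\ell$. Then $$\rho(\mathbb T)=\rho(\widetilde T)=|\lambda_{m+1}|<1,$$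 where $\rho$ denotes the spectral radius.
   Context: $\mathbb I$ is the identity on $\mathcal X$. The inner product is linear in its second argument. *)

theory Defs
  imports "Jordan_Normal_Form.Spectral_Radius"
begin

(* Families of vectors and eigenvalues are indexed from 0, like matrix and vector entries:
   v i stands for the (i+1)-st member of a family, 0 <= i < k. *)

text \<open>An inner product on \<open>\<complex>\<^sup>N\<close>, linear in its second argument (and
  hence, by conjugate symmetry, conjugate-linear in the first).\<close>

definition inner_product_on :: "nat \<Rightarrow> (complex vec \<Rightarrow> complex vec \<Rightarrow> complex) \<Rightarrow> bool" where
  "inner_product_on N ip \<longleftrightarrow>
     (\<forall>x\<in>carrier_vec N. \<forall>y\<in>carrier_vec N. \<forall>z\<in>carrier_vec N. ip x (y + z) = ip x y + ip x z) \<and>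
     (\<forall>x\<in>carrier_vec N. \<forall>y\<in>carrier_vec N. \<forall>c. ip x (c \<cdot>\<^sub>v y) = c * ip x y) \<and>
     (\<forall>x\<in>carrier_vec N. \<forall>y\<in>carrier_vec N. ip y x = cnj (ip x y)) \<and>
     (\<forall>x\<in>carrier_vec N. x \<noteq> 0\<^sub>v N \<longrightarrow> ip x x \<in> \<real> \<and> 0 < Re (ip x x))"

abbreviation vec_span :: "nat \<Rightarrow> complex vec set \<Rightarrow> complex vec set" where
  "vec_span N \<equiv> module.span class_ring (module_vec TYPE(complex) N)"

text \<open>Linear independence of a family, so that repeated members are excluded
  (hence the injectivity condition).\<close>

definition lin_indpt_family :: "nat \<Rightarrow> nat \<Rightarrow> (nat \<Rightarrow> complex vec) \<Rightarrow> bool" where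
  "lin_indpt_family N k v \<longleftrightarrow>
     v ` {..<k} \<subseteq> carrier_vec N \<and> inj_on v {..<k} \<and>
     \<not> module.lin_dep class_ring (module_vec TYPE(complex) N) (v ` {..<k})"

definition prolong :: "nat \<Rightarrow> nat \<Rightarrow> (nat \<Rightarrow> complex vec) \<Rightarrow> complex vec \<Rightarrow> complex vec" where
  "prolong N m p v = finsum_vec TYPE(complex) N (\<lambda>k. (v $ k) \<cdot>\<^sub>v p k) {..<m}"

definition coarse_restrict ::
  "(complex vec \<Rightarrow> complex vec \<Rightarrow> complex) \<Rightarrow> nat \<Rightarrow> (nat \<Rightarrow> complex vec) \<Rightarrow> complex vec \<Rightarrow> complex vec" where
  "coarse_restrict ip m p f = vec m (\<lambda>k. ip (p k) f)"

text \<open>The matrix, in the standard bases, of a linear map from \<open>\<complex>\<^sup>n\<close> to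
  \<open>\<complex>\<^sup>m\<close>.\<close>

definition matrix_of_map :: "nat \<Rightarrow> nat \<Rightarrow> (complex vec \<Rightarrow> complex vec) \<Rightarrow> complex mat" where
  "matrix_of_map m n F = mat m n (\<lambda>(i, j). F (unit_vec n j) $ i)"

definition prolong_mat :: "nat \<Rightarrow> nat \<Rightarrow> (nat \<Rightarrow> complex vec) \<Rightarrow> complex mat" where
  "prolong_mat N m p = matrix_of_map N m (prolong N m p)"

definition restrict_mat ::
  "nat \<Rightarrow> (complex vec \<Rightarrow> complex vec \<Rightarrow> complex) \<Rightarrow> nat \<Rightarrow> (nat \<Rightarrow> complex vec) \<Rightarrow> complex mat" where
  "restrict_mat N ip m p = matrix_of_map m N (coarse_restrict ip m p)"

definition coarse_mat ::
  "complex mat \<Rightarrow> complex mat \<Rightarrow> complex mat \<Rightarrow> complex mat" where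
  "coarse_mat R A P = R * A * P"

text \<open>Here \<^term>\<open>the (mat_inverse M)\<close> is the inverse of \<^term>\<open>M\<close> if there is
  one, and unspecified otherwise.\<close>

definition two_level_mat ::
  "nat \<Rightarrow> complex mat \<Rightarrow> complex mat \<Rightarrow> complex mat \<Rightarrow> complex mat \<Rightarrow> complex mat" where
  "two_level_mat N A G P R = (1\<^sub>m N - P * the (mat_inverse (coarse_mat R A P)) * R * A) * G"

lemma matrix_of_map_apply:
  assumes F: "\<And>v. v \<in> carrier_vec n \<Longrightarrow> F v \<in> carrier_vec m"
    and add: "\<And>v w. v \<in> carrier_vec n \<Longrightarrow> w \<in> carrier_vec n \<Longrightarrow> F (v + w) = F v + F w"
    and smult: "\<And>c v. v \<in> carrier_vec n \<Longrightarrow> F (c \<cdot>\<^sub>v v) = c \<cdot>\<^sub>v F v"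
    and v: "v \<in> carrier_vec n"
  shows "matrix_of_map m n F *\<^sub>v v = F v"
proof (rule eq_vecI)
  show "dim_vec (matrix_of_map m n F *\<^sub>v v) = dim_vec (F v)"
    using F[OF v] by (simp add: matrix_of_map_def)
  fix i assume "i < dim_vec (F v)"
  then have i: "i < m" using F[OF v] by simp
  let ?t = "\<lambda>k. vec n (\<lambda>j. if j < k then v $ j else 0)"
  have part: "k \<le> n \<Longrightarrow> F (?t k) $ i = (\<Sum>j<k. v $ j * F (unit_vec n j) $ i)" for k
  proof (induction k)
    case 0
    have "?t 0 = 0 \<cdot>\<^sub>v unit_vec n 0" by (rule eq_vecI) auto
    then have "F (?t 0) = 0 \<cdot>\<^sub>v F (unit_vec n 0)" by (simp only: smult unit_vec_carrier)
    moreover have "dim_vec (F (unit_vec n 0)) = m"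
      using F[of "unit_vec n 0"] by auto
    ultimately show ?case using i by simp
  next
    case (Suc k)
    have s: "?t (Suc k) = ?t k + v $ k \<cdot>\<^sub>v unit_vec n k"
      using Suc.prems by (intro eq_vecI) (auto simp: less_Suc_eq unit_vec_def)
    have "F (?t (Suc k)) = F (?t k) + v $ k \<cdot>\<^sub>v F (unit_vec n k)"
      unfolding s by (subst add) (auto simp: smult)
    moreover have "dim_vec (F (?t k)) = m" "dim_vec (F (unit_vec n k)) = m"
      using F[of "?t k"] F[of "unit_vec n k"] by auto
    ultimately show ?case using i Suc by simp
  qed
  have "?t n = v" using v by (intro eq_vecI) auto
  then have "F v $ i = (\<Sum>j<n. v $ j * F (unit_vec n j) $ i)" using part[of n] by simp
  also have "\<dots> = (matrix_of_map m n F *\<^sub>v v) $ i"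
    using i v by (auto simp: matrix_of_map_def scalar_prod_def row_def atLeast0LessThan mult.commute
        intro!: sum.cong)
  finally show "(matrix_of_map m n F *\<^sub>v v) $ i = F v $ i" by simp
qed

lemma prolong_mat_apply:
  assumes p: "\<And>k. k < m \<Longrightarrow> p k \<in> carrier_vec N" and v: "v \<in> carrier_vec m"
  shows "prolong_mat N m p *\<^sub>v v = prolong N m p v"
proof -
  have c: "prolong N m p v \<in> carrier_vec N" for v
    unfolding prolong_def using p by (intro finsum_vec_closed) auto
  have ix: "prolong N m p v $ i = (\<Sum>k<m. v $ k * p k $ i)" if "i < N" for v i
  proof -
    have d: "dim_vec (p k) = N" if "k < m" for k
      using p[OF that] by auto
    have "prolong N m p v $ i = (\<Sum>k<m. (v $ k \<cdot>\<^sub>v p k) $ i)"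
      unfolding prolong_def by (rule index_finsum_vec) (use p that in auto)
    also have "\<dots> = (\<Sum>k<m. v $ k * p k $ i)"
      by (rule sum.cong) (use d that in auto)
    finally show ?thesis .
  qed
  have d: "dim_vec (prolong N m p v) = N" for v using c[of v] by auto
  show ?thesis
    unfolding prolong_mat_def
  proof (rule matrix_of_map_apply[OF c _ _ v])
    fix v w :: "complex vec" assume "v \<in> carrier_vec m" "w \<in> carrier_vec m"
    then show "prolong N m p (v + w) = prolong N m p v + prolong N m p w"
      by (intro eq_vecI) (auto simp: d ix distrib_right sum.distrib)
  next
    fix c and v :: "complex vec" assume "v \<in> carrier_vec m"
    then show "prolong N m p (c \<cdot>\<^sub>v v) = c \<cdot>\<^sub>v prolong N m p v"
      by (intro eq_vecI) (auto simp: d ix sum_distrib_left mult.assoc)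
  qed
qed

lemma restrict_mat_apply:
  assumes "inner_product_on N ip" and "\<And>k. k < m \<Longrightarrow> p k \<in> carrier_vec N"
    and "f \<in> carrier_vec N"
  shows "restrict_mat N ip m p *\<^sub>v f = coarse_restrict ip m p f"
proof -
  have add: "ip (p k) (y + z) = ip (p k) y + ip (p k) z"
    if "k < m" "y \<in> carrier_vec N" "z \<in> carrier_vec N" for k y z
    using assms(1) assms(2)[OF that(1)] that(2,3) unfolding inner_product_on_def by blast
  have smult: "ip (p k) (c \<cdot>\<^sub>v y) = c * ip (p k) y"
    if "k < m" "y \<in> carrier_vec N" for k c y
    using assms(1) assms(2)[OF that(1)] that(2) unfolding inner_product_on_def by blast
  show ?thesis
    unfolding restrict_mat_def using assms(3)
    by (intro matrix_of_map_apply) (auto simp: coarse_restrict_def add smult)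
qed

lemma the_mat_inverse:
  fixes M :: "complex mat"
  assumes M: "M \<in> carrier_mat n n" and inv: "invertible_mat M"
  shows "the (mat_inverse M) \<in> carrier_mat n n"
    and "M * the (mat_inverse M) = 1\<^sub>m n" and "the (mat_inverse M) * M = 1\<^sub>m n"
proof -
  obtain B where B: "M * B = 1\<^sub>m n" "B * M = 1\<^sub>m (dim_row B)"
    using inv M unfolding invertible_mat_def inverts_mat_def by auto
  have "dim_col B = n" using arg_cong[OF B(1), of dim_col] by simp
  moreover have "dim_row B = n" using arg_cong[OF B(2), of dim_col] M by simp
  ultimately have "M \<in> Units (ring_mat TYPE(complex) n ())"
    using B M by (auto simp: Units_def ring_mat_def intro!: bexI[of _ B])
  then obtain C where "mat_inverse M = Some C"
    using mat_inverse(1)[OF M, of "()"] by (cases "mat_inverse M") auto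
  with mat_inverse(2)[OF M this]
  show "the (mat_inverse M) \<in> carrier_mat n n"
    and "M * the (mat_inverse M) = 1\<^sub>m n" and "the (mat_inverse M) * M = 1\<^sub>m n" by auto
qed

end

theory Submission
  imports Defs "Jordan_Normal_Form.DL_Rank"
begin

text \<open>The map \<open>T\<close> is the smoother \<open>G\<close> followed by \<open>I - \<Pi>\<close>, where
  \<open>\<Pi> = P A\<^sub>c\<^sup>-\<^sup>1 R A\<close> is a projection onto the range of \<open>P\<close>: its values lie there by construction, and
  \<open>\<Pi> P = P\<close> because \<open>A\<^sub>c = R A P\<close> (\<open>coarse_projection_fixes_range\<close>). That range is the span of the
  first \<open>m\<close> eigenvectors \<open>\<psi>\<^sub>j\<close> of \<open>G\<close>. Hence \<open>T \<psi>\<^sub>j = 0\<close> for \<open>j < m\<close> (indices start at \<open>0\<close>), while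
  for \<open>j \<ge> m\<close> the vector \<open>T \<psi>\<^sub>j = \<lambda>\<^sub>j \<psi>\<^sub>j - \<lambda>\<^sub>j \<Pi> \<psi>\<^sub>j\<close> differs from \<open>\<lambda>\<^sub>j \<psi>\<^sub>j\<close> only by a combination of
  \<open>\<psi>\<^sub>0, \<dots>, \<psi>\<^sub>m\<^sub>-\<^sub>1\<close>. The coefficients of \<open>T \<psi>\<^sub>j\<close> form row \<open>j\<close> of the matrix in the basis of the
  \<open>\<psi>\<^sub>j\<close>, so that matrix is lower triangular with diagonal
  \<open>0, \<dots>, 0, \<lambda>\<^sub>m, \<dots>, \<lambda>\<^sub>N\<^sub>-\<^sub>1\<close>. Its eigenvalues are the diagonal entries, and since
  the moduli \<open>|\<lambda>\<^sub>j|\<close> do not increase with \<open>j\<close>, the largest modulus is \<open>|\<lambda>\<^sub>m|\<close>.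

  The matrix in the basis of the \<open>\<psi>\<^sub>j\<close> and \<open>T\<close> have the same spectral radius, because \<open>T\<close> is similar
  to the transpose of that matrix (\<open>spectral_radius_basis_expansion\<close>). Everything is phrased with the
  matrix \<open>X\<close> whose columns are the \<open>\<psi>\<^sub>j\<close>: a combination of the \<open>\<psi>\<^sub>j\<close> is \<open>X\<close> times its coefficient
  vector, and linear independence makes \<open>X\<close> invertible, so that coefficients can be compared.\<close>

section \<open>Linear combinations as matrix-vector products\<close>

lemma linear_combination_as_mat_mult:
  assumes "\<And>k. k < m \<Longrightarrow> f k \<in> carrier_vec N"
  shows "finsum_vec TYPE(complex) N (\<lambda>k. c k \<cdot>\<^sub>v f k) {..<m}
    = mat_of_cols N (map f [0..<m]) *\<^sub>v vec m c"
proof (rule eq_vecI)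
  have d: "dim_vec (f k) = N" if "k < m" for k
    using assms[OF that] by auto
  have "finsum_vec TYPE(complex) N (\<lambda>k. c k \<cdot>\<^sub>v f k) {..<m} \<in> carrier_vec N"
    using assms by (intro finsum_vec_closed) auto
  then show "dim_vec (finsum_vec TYPE(complex) N (\<lambda>k. c k \<cdot>\<^sub>v f k) {..<m})
    = dim_vec (mat_of_cols N (map f [0..<m]) *\<^sub>v vec m c)" by simp
  fix i assume "i < dim_vec (mat_of_cols N (map f [0..<m]) *\<^sub>v vec m c)"
  then have i: "i < N" by simp
  have "finsum_vec TYPE(complex) N (\<lambda>k. c k \<cdot>\<^sub>v f k) {..<m} $ i = (\<Sum>k<m. (c k \<cdot>\<^sub>v f k) $ i)"
    by (rule index_finsum_vec) (use assms i in auto)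
  also have "\<dots> = (\<Sum>k<m. f k $ i * c k)"
    by (rule sum.cong) (use d i in auto)
  also have "\<dots> = (mat_of_cols N (map f [0..<m]) *\<^sub>v vec m c) $ i"
    using i by (auto simp: scalar_prod_def mat_of_cols_def atLeast0LessThan intro!: sum.cong)
  finally show "finsum_vec TYPE(complex) N (\<lambda>k. c k \<cdot>\<^sub>v f k) {..<m} $ i
    = (mat_of_cols N (map f [0..<m]) *\<^sub>v vec m c) $ i" .
qed

lemma mat_of_cols_mult_unit_vec:
  assumes "j < m" and "f j \<in> carrier_vec N"
  shows "mat_of_cols N (map f [0..<m]) *\<^sub>v unit_vec m j = (f j :: complex vec)"
  using assms by (intro eq_vecI) (auto simp: mat_of_cols_def)

lemma vec_span_family:
  assumes "\<And>k. k < m \<Longrightarrow> f k \<in> carrier_vec N"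
  shows "vec_span N (f ` {..<m}) = (\<lambda>c. mat_of_cols N (map f [0..<m]) *\<^sub>v c) ` carrier_vec m"
proof -
  let ?M = "mat_of_cols N (map f [0..<m])"
  have M: "?M \<in> carrier_mat N m" using mat_of_cols_carrier(1)[of N "map f [0..<m]"] by simp
  have "set (map f [0..<m]) \<subseteq> carrier_vec N" using assms by auto
  then have "cols ?M = map f [0..<m]" by (rule cols_mat_of_cols)
  then have "set (cols ?M) = f ` {..<m}" by (simp add: atLeast0LessThan)
  then have "vec_span N (f ` {..<m}) = vec_space.col_space N ?M"
    by (simp add: vec_space.col_space_def)
  also have "\<dots> = (\<lambda>c. ?M *\<^sub>v c) ` carrier_vec m"
    using vec_space.col_space_eq[OF M] M by (auto intro!: mult_mat_vec_carrier)
  finally show ?thesis .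
qed

text \<open>Padding with zeros expresses the members of the span of an initial segment through the matrix
  of the whole family.\<close>

lemma span_initial_segment_padded:
  assumes f: "\<And>k. k < N \<Longrightarrow> f k \<in> carrier_vec N" and "m \<le> N"
    and x: "x \<in> vec_span N (f ` {..<m})"
  shows "\<exists>c\<in>carrier_vec N. (\<forall>l\<in>{m..<N}. c $ l = 0)
    \<and> x = mat_of_cols N (map f [0..<N]) *\<^sub>v c"
proof -
  have f': "\<And>k. k < m \<Longrightarrow> f k \<in> carrier_vec N" using f \<open>m \<le> N\<close> by auto
  from x obtain z where z: "z \<in> carrier_vec m" "x = mat_of_cols N (map f [0..<m]) *\<^sub>v z"
    using vec_span_family[of m f N, OF f'] by blast
  let ?c = "vec N (\<lambda>l. if l < m then z $ l else 0)"
  have "mat_of_cols N (map f [0..<m]) *\<^sub>v z = mat_of_cols N (map f [0..<N]) *\<^sub>v ?c"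
  proof (rule eq_vecI)
    fix i assume "i < dim_vec (mat_of_cols N (map f [0..<N]) *\<^sub>v ?c)"
    then have i: "i < N" by simp
    have "(mat_of_cols N (map f [0..<m]) *\<^sub>v z) $ i = (\<Sum>k<m. f k $ i * z $ k)"
      using i z(1) by (auto simp: scalar_prod_def mat_of_cols_def atLeast0LessThan intro!: sum.cong)
    also have "\<dots> = (\<Sum>k<N. f k $ i * (if k < m then z $ k else 0))"
      using \<open>m \<le> N\<close> by (intro sum.mono_neutral_cong_left) auto
    also have "\<dots> = (mat_of_cols N (map f [0..<N]) *\<^sub>v ?c) $ i"
      using i by (auto simp: scalar_prod_def mat_of_cols_def atLeast0LessThan intro!: sum.cong)
    finally show "(mat_of_cols N (map f [0..<m]) *\<^sub>v z) $ i
      = (mat_of_cols N (map f [0..<N]) *\<^sub>v ?c) $ i" .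
  qed simp
  then show ?thesis using z(2) by (intro bexI[of _ ?c]) auto
qed

lemma basis_matrix_inverse:
  assumes "lin_indpt_family N N f"
  obtains Y where "Y \<in> carrier_mat N N" "Y * mat_of_cols N (map f [0..<N]) = 1\<^sub>m N"
    "mat_of_cols N (map f [0..<N]) * Y = 1\<^sub>m N"
proof -
  let ?X = "mat_of_cols N (map f [0..<N])"
  have X: "?X \<in> carrier_mat N N" using mat_of_cols_carrier(1)[of N "map f [0..<N]"] by simp
  have f: "f ` {..<N} \<subseteq> carrier_vec N" "inj_on f {..<N}"
    "\<not> module.lin_dep class_ring (module_vec TYPE(complex) N) (f ` {..<N})"
    using assms unfolding lin_indpt_family_def by auto
  have "set (map f [0..<N]) \<subseteq> carrier_vec N" using f(1) by auto
  then have cols: "cols ?X = map f [0..<N]" by (rule cols_mat_of_cols)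
  have "vec_space.rank N ?X = N"
  proof (rule vec_space.lin_indpt_full_rank[OF X])
    show "distinct (cols ?X)" unfolding cols using f(2) by (simp add: distinct_map atLeast0LessThan)
    show "\<not> module.lin_dep class_ring (module_vec TYPE(complex) N) (set (cols ?X))"
      unfolding cols using f(3) by (simp add: atLeast0LessThan)
  qed
  then have "det ?X \<noteq> 0" using vec_space.det_rank_iff[OF X] by simp
  from det_non_zero_imp_unit[OF X this, of "()"]
  obtain Y where "Y \<in> carrier_mat N N" "Y * ?X = 1\<^sub>m N" "?X * Y = 1\<^sub>m N"
    by (auto simp: Units_def ring_mat_def)
  then show thesis by (rule that)
qed

section \<open>Spectral radius and change of basis\<close>

lemma spectral_radius_cong_char_poly:
  assumes "A \<in> carrier_mat n n" "B \<in> carrier_mat n n" "char_poly A = char_poly B"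
  shows "spectral_radius A = spectral_radius B"
  using assms by (simp add: spectral_radius_def spectrum_root_char_poly)

text \<open>The expansion of \<open>T \<psi>\<^sub>j\<close> is stored in row \<open>j\<close>, so the hypothesis says \<open>T X = X M\<^sup>T\<close>; similarity
  and transposition both preserve the characteristic polynomial.\<close>

lemma spectral_radius_basis_expansion:
  assumes T: "T \<in> carrier_mat N N" and M: "M \<in> carrier_mat N N"
    and f: "lin_indpt_family N N f"
    and expansion: "\<And>j. j < N \<Longrightarrow> T *\<^sub>v f j = mat_of_cols N (map f [0..<N]) *\<^sub>v row M j"
  shows "spectral_radius T = spectral_radius M"
proof -
  let ?X = "mat_of_cols N (map f [0..<N])"
  have X: "?X \<in> carrier_mat N N" using mat_of_cols_carrier(1)[of N "map f [0..<N]"] by simp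
  obtain Y where Y: "Y \<in> carrier_mat N N" "Y * ?X = 1\<^sub>m N" "?X * Y = 1\<^sub>m N"
    using basis_matrix_inverse[OF f] by blast
  have fc: "f j \<in> carrier_vec N" if "j < N" for j
    using f that unfolding lin_indpt_family_def by auto
  have TX: "T * ?X = ?X * M\<^sup>T"
  proof (rule mat_col_eqI)
    fix j assume "j < dim_col (?X * M\<^sup>T)"
    then have j: "j < N" using M by simp
    have "col ?X j = f j" using j fc by (subst col_mat_of_cols) auto
    then have "col (T * ?X) j = T *\<^sub>v f j" using j by (simp add: col_mult2[OF T X j])
    also have "\<dots> = ?X *\<^sub>v col M\<^sup>T j" using j M by (simp add: expansion)
    also have "\<dots> = col (?X * M\<^sup>T) j" using j M by (subst col_mult2[OF X]) auto
    finally show "col (T * ?X) j = col (?X * M\<^sup>T) j" .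
  qed (use T M in auto)
  have "T = T * ?X * Y"
    using assoc_mult_mat[OF T X Y(1)] Y(3) T by simp
  then have "similar_mat T M\<^sup>T"
    using T M X Y TX by (intro similar_matI[of _ _ ?X Y N]) auto
  then have "char_poly T = char_poly M"
    using M by (simp add: char_poly_similar)
  then show ?thesis by (rule spectral_radius_cong_char_poly[OF T M])
qed

lemma spectral_radius_lower_triangular:
  assumes M: "M \<in> carrier_mat n n"
    and lower: "\<And>i j. i < j \<Longrightarrow> j < n \<Longrightarrow> M $$ (i, j) = 0"
  shows "spectral_radius M = Max ((\<lambda>i. norm (M $$ (i, i))) ` {..<n})"
proof -
  have "upper_triangular M\<^sup>T" using M lower by auto
  then have "char_poly M\<^sup>T = (\<Prod>a\<leftarrow>diag_mat M\<^sup>T. [:- a, 1:])"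
    using M by (intro char_poly_upper_triangular) auto
  moreover have "diag_mat M\<^sup>T = diag_mat M" using M by (intro diag_mat_transpose) auto
  ultimately have "char_poly M = (\<Prod>a\<leftarrow>diag_mat M. [:- a, 1:])"
    using M by simp
  then have "poly (char_poly M) k = 0 \<longleftrightarrow> k \<in> set (diag_mat M)" for k
    by (auto simp: poly_prod_list prod_list_zero_iff)
  then have "spectrum M = (\<lambda>i. M $$ (i, i)) ` {..<n}"
    using M by (simp add: spectrum_root_char_poly[OF M] diag_mat_def atLeast0LessThan)
  then show ?thesis by (simp add: spectral_radius_def image_image)
qed

section \<open>The coarse projection\<close>

lemma coarse_projection_apply:
  fixes A P R B :: "complex mat"
  assumes "A \<in> carrier_mat N N" "P \<in> carrier_mat N m" "R \<in> carrier_mat m N"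
    "B \<in> carrier_mat m m" "x \<in> carrier_vec N"
  shows "(P * B * R * A) *\<^sub>v x = P *\<^sub>v (B *\<^sub>v (R *\<^sub>v (A *\<^sub>v x)))"
proof -
  have "(P * B * R * A) *\<^sub>v x = (P * B * R) *\<^sub>v (A *\<^sub>v x)"
    using assms by (intro assoc_mult_mat_vec) auto
  also have "\<dots> = (P * B) *\<^sub>v (R *\<^sub>v (A *\<^sub>v x))"
    using assms by (intro assoc_mult_mat_vec) auto
  also have "\<dots> = P *\<^sub>v (B *\<^sub>v (R *\<^sub>v (A *\<^sub>v x)))"
    using assms by (intro assoc_mult_mat_vec) auto
  finally show ?thesis .
qed

text \<open>Applied to \<open>P v\<close>, the factors \<open>R A P\<close> recombine to \<open>A\<^sub>c\<close>, which its inverse cancels.\<close>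

lemma coarse_projection_fixes_range:
  fixes A P R :: "complex mat"
  assumes A: "A \<in> carrier_mat N N" and P: "P \<in> carrier_mat N m" and R: "R \<in> carrier_mat m N"
    and Ac: "invertible_mat (coarse_mat R A P)" and v: "v \<in> carrier_vec m"
  shows "(P * the (mat_inverse (coarse_mat R A P)) * R * A) *\<^sub>v (P *\<^sub>v v) = P *\<^sub>v v"
proof -
  let ?B = "the (mat_inverse (coarse_mat R A P))"
  have C: "coarse_mat R A P \<in> carrier_mat m m" using A P R by (simp add: coarse_mat_def)
  note B = the_mat_inverse[OF C Ac]
  have "R *\<^sub>v (A *\<^sub>v (P *\<^sub>v v)) = (R * A) *\<^sub>v (P *\<^sub>v v)"
    by (rule assoc_mult_mat_vec[OF R A, symmetric]) (use P v in auto)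
  also have "\<dots> = coarse_mat R A P *\<^sub>v v"
    unfolding coarse_mat_def by (rule assoc_mult_mat_vec[symmetric]) (use A P R v in auto)
  finally have "?B *\<^sub>v (R *\<^sub>v (A *\<^sub>v (P *\<^sub>v v))) = (?B * coarse_mat R A P) *\<^sub>v v"
    using assoc_mult_mat_vec[OF B(1) C v] by simp
  also have "\<dots> = v" using B(3) v by simp
  finally show ?thesis using P v by (simp add: coarse_projection_apply[OF A P R B(1)])
qed

section \<open>The two-level operator\<close>

theorem theorem4p5:
  fixes N m :: nat
    and ip :: "complex vec \<Rightarrow> complex vec \<Rightarrow> complex"
    and A G P R T Tt :: "complex mat"
    and psi p :: "nat \<Rightarrow> complex vec"
    and lamA lam :: "nat \<Rightarrow> complex"
  assumes ip: "inner_product_on N ip"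
    and A: "A \<in> carrier_mat N N" "invertible_mat A"
    and G: "G \<in> carrier_mat N N"
    and psi_indpt: "lin_indpt_family N N psi"
    and eigen_A: "\<And>k. k < N \<Longrightarrow> eigenvector A (psi k) (lamA k)"
    and eigen_G: "\<And>k. k < N \<Longrightarrow> eigenvector G (psi k) (lam k)"
    and lam_bounds: "\<And>k. k < N \<Longrightarrow> 0 < norm (lam k) \<and> norm (lam k) < 1"
    and lam_order: "\<And>k. 1 \<le> k \<Longrightarrow> k < N \<Longrightarrow> norm (lam k) \<le> norm (lam (k - 1))"
    and m: "m < N"
    and p_indpt: "lin_indpt_family N m p"
    and p_span: "vec_span N (p ` {..<m}) = vec_span N (psi ` {..<m})"
    and P: "P = prolong_mat N m p"
    and R: "R = restrict_mat N ip m p"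
    and Ac: "invertible_mat (coarse_mat R A P)"
    and T: "T = two_level_mat N A G P R"
    and Tt: "Tt \<in> carrier_mat N N"
      "\<And>j. j < N \<Longrightarrow>
         T *\<^sub>v psi j = finsum_vec TYPE(complex) N (\<lambda>l. Tt $$ (j, l) \<cdot>\<^sub>v psi l) {..<N}"
  shows "spectral_radius T = spectral_radius Tt
    \<and> spectral_radius Tt = norm (lam m)
    \<and> norm (lam m) < 1"
proof -
  let ?X = "mat_of_cols N (map psi [0..<N])"
  let ?Ppsi = "mat_of_cols N (map psi [0..<m])"
  have X: "?X \<in> carrier_mat N N" using mat_of_cols_carrier(1)[of N "map psi [0..<N]"] by simp
  obtain Y where Y: "Y \<in> carrier_mat N N" "Y * ?X = 1\<^sub>m N"
    using basis_matrix_inverse[OF psi_indpt] by blast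
  have psi: "psi k \<in> carrier_vec N" if "k < N" for k
    using psi_indpt that unfolding lin_indpt_family_def by auto
  have p: "p k \<in> carrier_vec N" if "k < m" for k
    using p_indpt that unfolding lin_indpt_family_def by auto
  have Pc: "P \<in> carrier_mat N m" by (simp add: P prolong_mat_def matrix_of_map_def)
  have Rc: "R \<in> carrier_mat m N" by (simp add: R restrict_mat_def matrix_of_map_def)

  define B where "B = the (mat_inverse (coarse_mat R A P))"
  have Bc: "B \<in> carrier_mat m m"
    unfolding B_def by (rule the_mat_inverse[OF _ Ac]) (use A Pc Rc in \<open>simp add: coarse_mat_def\<close>)
  define Q where "Q = P * B * R * A"
  have Qc: "Q \<in> carrier_mat N N" using A Pc Rc Bc by (auto simp: Q_def)
  have Teq: "T = (1\<^sub>m N - Q) * G" by (simp add: T two_level_mat_def Q_def B_def)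
  have IQ: "1\<^sub>m N - Q \<in> carrier_mat N N" using Qc by (rule minus_carrier_mat)
  have Tc: "T \<in> carrier_mat N N" unfolding Teq using IQ G by (rule mult_carrier_mat)

  have Pspan: "(\<lambda>v. P *\<^sub>v v) ` carrier_vec m = vec_span N (psi ` {..<m})"
  proof -
    have "P *\<^sub>v v = mat_of_cols N (map p [0..<m]) *\<^sub>v v" if v: "v \<in> carrier_vec m" for v
    proof -
      have "vec m (\<lambda>k. v $ k) = v" using v by auto
      then show ?thesis
        using linear_combination_as_mat_mult[of m p N "\<lambda>k. v $ k"] p
        by (simp add: P prolong_mat_apply[OF p v] prolong_def)
    qed
    then show ?thesis unfolding p_span[symmetric] by (subst vec_span_family[of m p N, OF p]) auto
  qed

  have Tpsi: "T *\<^sub>v psi j = lam j \<cdot>\<^sub>v (psi j - Q *\<^sub>v psi j)" if j: "j < N" for j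
  proof -
    have "G *\<^sub>v psi j = lam j \<cdot>\<^sub>v psi j" using eigen_G[OF j] by (simp add: eigenvector_def)
    then have "T *\<^sub>v psi j = (1\<^sub>m N - Q) *\<^sub>v (lam j \<cdot>\<^sub>v psi j)"
      unfolding Teq using assoc_mult_mat_vec[OF IQ G psi[OF j]] by simp
    also have "\<dots> = lam j \<cdot>\<^sub>v ((1\<^sub>m N - Q) *\<^sub>v psi j)"
      using IQ psi[OF j] by (rule mult_mat_vec)
    also have "(1\<^sub>m N - Q) *\<^sub>v psi j = psi j - Q *\<^sub>v psi j"
      using Qc psi[OF j] by (subst minus_mult_distrib_mat_vec[of _ N N]) auto
    finally show ?thesis .
  qed

  have rowc: "row Tt j \<in> carrier_vec N" for j using Tt(1) by (simp add: row_def)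
  have expansion: "T *\<^sub>v psi j = ?X *\<^sub>v row Tt j" if j: "j < N" for j
  proof -
    have "vec N (\<lambda>l. Tt $$ (j, l)) = row Tt j" using Tt(1) by (simp add: row_def)
    then show ?thesis
      using Tt(2)[OF j] linear_combination_as_mat_mult[of N psi N "\<lambda>l. Tt $$ (j, l)"] psi
      by simp
  qed
  \<comment> \<open>Since \<open>X\<close> has a left inverse, any expansion of \<open>T \<psi>\<^sub>j\<close> identifies row \<open>j\<close> of the matrix.\<close>
  have coeffs: "row Tt j = c" if "j < N" "c \<in> carrier_vec N" "T *\<^sub>v psi j = ?X *\<^sub>v c" for j c
  proof -
    have "Y *\<^sub>v (?X *\<^sub>v d) = d" if "d \<in> carrier_vec N" for d
      using assoc_mult_mat_vec[OF Y(1) X that] Y(2) that by simp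
    from this[OF rowc[of j]] this[OF that(2)] show ?thesis
      using expansion[OF that(1)] that(3) by simp
  qed

  \<comment> \<open>For \<open>j < m\<close>, \<open>\<psi>\<^sub>j\<close> lies in the range of \<open>P\<close>, which the projection fixes: \<open>I - Q\<close> kills it.\<close>
  have row_low: "row Tt j = 0\<^sub>v N" if j: "j < m" for j
  proof -
    have jN: "j < N" using j m by simp
    have "psi j \<in> vec_span N (psi ` {..<m})"
    proof -
      have "psi j = ?Ppsi *\<^sub>v unit_vec m j"
        by (rule mat_of_cols_mult_unit_vec[of j m psi N, OF j psi[OF jN], symmetric])
      moreover have "psi k \<in> carrier_vec N" if "k < m" for k using psi that m by simp
      ultimately show ?thesis
        using vec_span_family[of m psi N] unit_vec_carrier by blast
    qed
    then obtain v where v: "v \<in> carrier_vec m" "psi j = P *\<^sub>v v"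
      unfolding Pspan[symmetric] by blast
    have "Q *\<^sub>v psi j = psi j"
      unfolding v(2) Q_def B_def by (rule coarse_projection_fixes_range[OF A(1) Pc Rc Ac v(1)])
    then have "T *\<^sub>v psi j = lam j \<cdot>\<^sub>v 0\<^sub>v N" using Tpsi[OF jN] psi[OF jN] by simp
    also have "\<dots> = ?X *\<^sub>v 0\<^sub>v N" by (intro eq_vecI) (auto simp: scalar_prod_def)
    finally show ?thesis by (intro coeffs[OF jN]) auto
  qed

  \<comment> \<open>For \<open>j \<ge> m\<close>, \<open>Q \<psi>\<^sub>j\<close> only contributes coefficients in the columns below \<open>m\<close>.\<close>
  have row_high: "Tt $$ (j, l) = (if l = j then lam j else 0)"
    if jl: "m \<le> j" "j < N" "m \<le> l" "l < N" for j l
  proof -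
    have "Q *\<^sub>v psi j = P *\<^sub>v (B *\<^sub>v (R *\<^sub>v (A *\<^sub>v psi j)))"
      unfolding Q_def by (rule coarse_projection_apply[OF A(1) Pc Rc Bc psi[OF jl(2)]])
    moreover have "B *\<^sub>v (R *\<^sub>v (A *\<^sub>v psi j)) \<in> carrier_vec m"
      by (intro mult_mat_vec_carrier[OF Bc] mult_mat_vec_carrier[OF Rc]
          mult_mat_vec_carrier[OF A(1)] psi[OF jl(2)])
    ultimately have "Q *\<^sub>v psi j \<in> vec_span N (psi ` {..<m})"
      unfolding Pspan[symmetric] by (rule image_eqI)
    from span_initial_segment_padded[of N psi m, OF psi less_imp_le[OF m] this]
    obtain c where c: "c \<in> carrier_vec N" "\<forall>l\<in>{m..<N}. c $ l = 0" "Q *\<^sub>v psi j = ?X *\<^sub>v c"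
      by blast
    have "T *\<^sub>v psi j = lam j \<cdot>\<^sub>v (psi j - ?X *\<^sub>v c)"
      unfolding c(3)[symmetric] by (rule Tpsi[OF jl(2)])
    also have "\<dots> = lam j \<cdot>\<^sub>v (?X *\<^sub>v unit_vec N j - ?X *\<^sub>v c)"
      by (subst mat_of_cols_mult_unit_vec[of j N psi N, OF jl(2) psi[OF jl(2)]]) (rule refl)
    also have "\<dots> = lam j \<cdot>\<^sub>v (?X *\<^sub>v (unit_vec N j - c))"
      using mult_minus_distrib_mat_vec[OF X unit_vec_carrier c(1)] by simp
    also have "\<dots> = ?X *\<^sub>v (lam j \<cdot>\<^sub>v (unit_vec N j - c))"
      using X c(1) by (intro mult_mat_vec[symmetric, of _ N N]) auto
    finally have "row Tt j = lam j \<cdot>\<^sub>v (unit_vec N j - c)"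
      using c(1) by (intro coeffs[OF jl(2)]) auto
    then have "row Tt j $ l = (lam j \<cdot>\<^sub>v (unit_vec N j - c)) $ l" by simp
    then show ?thesis using jl c Tt(1) by (auto simp: unit_vec_def)
  qed

  have entry_low: "Tt $$ (j, l) = 0" if "j < m" "l < N" for j l
  proof -
    have "row Tt j $ l = 0" using row_low[OF that(1)] that(2) by simp
    then show ?thesis using that Tt(1) m by simp
  qed
  have lower: "Tt $$ (i, j) = 0" if "i < j" "j < N" for i j
    using entry_low[of i j] row_high[of i j] that by (cases "i < m") auto

  \<comment> \<open>Index \<open>m\<close> is the first one whose eigenvalue survives, hence the one of largest modulus.\<close>
  have norm_lam_le: "norm (lam j) \<le> norm (lam m)" if "m \<le> j" "j < N" for j
    using that
  proof (induction j rule: dec_induct)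
    case (step j)
    then show ?case using lam_order[of "Suc j"] by simp
  qed simp
  have "spectral_radius Tt = Max ((\<lambda>i. norm (Tt $$ (i, i))) ` {..<N})"
    by (rule spectral_radius_lower_triangular[OF Tt(1) lower])
  also have "\<dots> = norm (lam m)"
  proof (rule Max_eqI)
    fix y assume "y \<in> (\<lambda>i. norm (Tt $$ (i, i))) ` {..<N}"
    then obtain i where i: "i < N" "y = norm (Tt $$ (i, i))" by auto
    show "y \<le> norm (lam m)"
      using i entry_low[of i i] row_high[of i i] norm_lam_le[of i] by (cases "i < m") auto
  next
    show "norm (lam m) \<in> (\<lambda>i. norm (Tt $$ (i, i))) ` {..<N}"
      using m row_high[of m m] by (intro image_eqI[of _ _ m]) auto
  qed simp
  finally have "spectral_radius Tt = norm (lam m)" .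
  moreover have "spectral_radius T = spectral_radius Tt"
    by (rule spectral_radius_basis_expansion[OF Tc Tt(1) psi_indpt expansion])
  ultimately show ?thesis using lam_bounds[OF m] by simp
qed

end
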